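(* Let $P$ be a finite set of nonempty Cayley permutations. There exists a finite set $Q \subset \mathcal{I} \cap \mathcal{P}$ such that $\mathcal{I}(P) = \mathcal{I}(Q)$.
   Context: An inversion sequence of length $n$ is an integer sequence $\sigma=(\sigma_1,\dots,\sigma_n)$ with $\sigma_i\in\{0,\dots,i-1\}$ for all $i$; $\mathcal I$ is the set of all inversion sequences (of all lengths $n\ge0$). A Cayley permutation is an integer sequence whose set of values is exactly $\{0,\dots,m\}$ for its maximum $m$; $\mathcal P$ is the set of all Cayley permutations. For integer sequences $\sigma$ and $\rho$ with $1\le|\rho|\le|\sigma|$, $\sigma$ contains $\rho$ if some subsequence of $|\rho|$ entries of $\sigma$ has its values in the same relative order as $\rho$; otherwise $\sigma$ avoids $\rho$. For a set $S$ of integer sequences, $\mathcal I(S)$ denotes the set of inversion sequences avoiding every element of $S$. *)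

theory Defs
  imports Main "HOL-Library.Sublist"
begin

(* Lists are indexed from 0, so the 1-based condition "sigma_i in {0, ..., i - 1}"
   becomes "sigma ! i in {0, ..., i}". *)
definition inversion_sequences :: "int list set" where
  "inversion_sequences = {\<sigma>. \<forall>i<length \<sigma>. \<sigma> ! i \<in> {0..int i}}"

(* The empty sequence has no maximum; by convention it counts as a Cayley permutation. *)
definition cayley_permutations :: "int list set" where
  "cayley_permutations = {\<sigma>. \<sigma> = [] \<or> set \<sigma> = {0..Max (set \<sigma>)}}"

definition same_relative_order :: "int list \<Rightarrow> int list \<Rightarrow> bool" where
  "same_relative_order \<tau> \<rho> \<longleftrightarrow> length \<tau> = length \<rho> \<and>
     (\<forall>i<length \<rho>. \<forall>j<length \<rho>.
        (\<tau> ! i < \<tau> ! j \<longleftrightarrow> \<rho> ! i < \<rho> ! j) \<and> (\<tau> ! i = \<tau> ! j \<longleftrightarrow> \<rho> ! i = \<rho> ! j))"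

(* Occurrences need not be contiguous: subseq is the scattered-sublist relation.
   The empty pattern is contained in no sequence. *)
definition contains :: "int list \<Rightarrow> int list \<Rightarrow> bool" where
  "contains \<sigma> \<rho> \<longleftrightarrow> 1 \<le> length \<rho> \<and> length \<rho> \<le> length \<sigma> \<and>
     (\<exists>\<tau>. subseq \<tau> \<sigma> \<and> same_relative_order \<tau> \<rho>)"

definition avoids :: "int list \<Rightarrow> int list \<Rightarrow> bool" where
  "avoids \<sigma> \<rho> \<longleftrightarrow> \<not> contains \<sigma> \<rho>"

definition inversion_sequences_avoiding :: "int list set \<Rightarrow> int list set" where
  "inversion_sequences_avoiding S = {\<sigma> \<in> inversion_sequences. \<forall>\<rho>\<in>S. avoids \<sigma> \<rho>}"

end

(* Among the subsequences of an inversion sequence that contain a pattern of length k and whose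
   standardization is an inversion sequence, take a shortest one, and fix an occurrence of the
   pattern in it. Call position i tight if exactly i distinct values lie below its entry. An entry
   outside the occurrence can be deleted if no later position is tight, or if its value is
   unrepeated: in the second case the value lies below every later tight entry, so the deletion
   lowers the rank of each such entry along with its index. By minimality, all positions after the last tight
   position belong to the occurrence, which leaves at most k repetitions of values and hence at most
   2k entries with a repeated value. The remaining entries belong to the occurrence, so the length is
   at most 3k, and finitely many standardizations arise. *)

theory Submission
  imports Defs
begin

section \<open>Relative order and transitivity of containment\<close>

lemma same_relative_order_sym:
  "same_relative_order \<tau> \<rho> \<Longrightarrow> same_relative_order \<rho> \<tau>"
  by (simp add: same_relative_order_def)

lemma same_relative_order_trans:
  "same_relative_order \<tau> \<rho> \<Longrightarrow> same_relative_order \<rho> \<pi> \<Longrightarrow> same_relative_order \<tau> \<pi>"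
  by (simp add: same_relative_order_def)

lemma same_relative_order_map:
  assumes "strict_mono_on (set \<tau>) f"
  shows "same_relative_order \<tau> (map f \<tau>)"
  using assms
  by (auto simp: same_relative_order_def strict_mono_on_less strict_mono_on_eq)

text \<open>Turns a condition on pairs of positions into an increasing relabelling of values, which
  acts on all subsequences at once.\<close>

lemma same_relative_order_imp_map:
  assumes "same_relative_order \<tau> \<rho>"
  obtains f where "strict_mono_on (set \<tau>) f" "\<rho> = map f \<tau>"
proof -
  have len: "length \<tau> = length \<rho>"
    using assms by (simp add: same_relative_order_def)
  \<comment> \<open>Which occurrence of \<open>x\<close> is chosen does not matter: equal entries of
    \<open>\<tau>\<close> sit over equal entries of \<open>\<rho>\<close>.\<close>
  define f where "f x = \<rho> ! (SOME i. i < length \<tau> \<and> \<tau> ! i = x)" for x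
  have f: "f (\<tau> ! i) = \<rho> ! i" if "i < length \<tau>" for i
  proof -
    let ?j = "SOME j. j < length \<tau> \<and> \<tau> ! j = \<tau> ! i"
    have "?j < length \<tau> \<and> \<tau> ! ?j = \<tau> ! i"
      by (rule someI[of _ i]) (simp add: that)
    then show ?thesis
      using assms that unfolding f_def same_relative_order_def by auto
  qed
  have "\<rho> = map f \<tau>"
    using len f by (simp add: list_eq_iff_nth_eq)
  moreover have "strict_mono_on (set \<tau>) f"
  proof (rule strict_mono_onI)
    fix x y assume "x \<in> set \<tau>" "y \<in> set \<tau>" "x < y"
    then show "f x < f y"
      using assms f len unfolding same_relative_order_def by (metis in_set_conv_nth)
  qed
  ultimately show ?thesis using that by blast
qed

lemma subseq_map_right_obtain:
  assumes "subseq xs (map f ys)"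
  obtains zs where "subseq zs ys" "xs = map f zs"
  using assms by (auto simp: subseq_conv_nths nths_map)

lemma contains_iff:
  "contains \<sigma> \<rho> \<longleftrightarrow> \<rho> \<noteq> [] \<and> (\<exists>\<tau>. subseq \<tau> \<sigma> \<and> same_relative_order \<tau> \<rho>)"
  by (cases \<rho>) (auto simp: contains_def same_relative_order_def dest: list_emb_length)

text \<open>The occurrence of \<open>\<rho>\<close> in \<open>\<pi>\<close> is pulled back along the
  relabelling that carries the occurrence of \<open>\<pi>\<close> in \<open>\<sigma>\<close> to
  \<open>\<pi>\<close>.\<close>

lemma contains_trans:
  assumes "contains \<sigma> \<pi>" "contains \<pi> \<rho>"
  shows "contains \<sigma> \<rho>"
proof -
  obtain \<tau> where \<tau>: "subseq \<tau> \<sigma>" "same_relative_order \<tau> \<pi>"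
    using assms(1) by (auto simp: contains_iff)
  obtain \<kappa> where \<kappa>: "subseq \<kappa> \<pi>" "same_relative_order \<kappa> \<rho>" and "\<rho> \<noteq> []"
    using assms(2) by (auto simp: contains_iff)
  obtain f where f: "strict_mono_on (set \<tau>) f" "\<pi> = map f \<tau>"
    using same_relative_order_imp_map[OF \<tau>(2)] .
  obtain \<tau>' where \<tau>': "subseq \<tau>' \<tau>" "\<kappa> = map f \<tau>'"
    using subseq_map_right_obtain \<kappa>(1) f(2) by metis
  have "strict_mono_on (set \<tau>') f"
    using f(1) by (rule monotone_on_subset)
      (use \<tau>'(1) in \<open>auto simp: subseq_conv_nths dest: in_set_nthsD\<close>)
  then have "same_relative_order \<tau>' \<rho>"
    using same_relative_order_map \<tau>'(2) \<kappa>(2) same_relative_order_trans by blast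
  moreover have "subseq \<tau>' \<sigma>"
    using \<tau>'(1) \<tau>(1) by (rule subseq_order.trans)
  ultimately show ?thesis
    using \<open>\<rho> \<noteq> []\<close> by (auto simp: contains_iff)
qed

section \<open>Ranks and standardization\<close>

definition rank :: "'a::linorder list \<Rightarrow> 'a \<Rightarrow> nat" where
  "rank xs x = card {y \<in> set xs. y < x}"

text \<open>The unique Cayley permutation in the same relative order as \<open>xs\<close>.\<close>

definition standardize :: "'a::linorder list \<Rightarrow> int list" where
  "standardize xs = map (\<lambda>x. int (rank xs x)) xs"

text \<open>Expresses on \<open>xs\<close> itself that its standardization is an inversion sequence,
  so entries can be deleted without relabelling the rest.\<close>

definition rank_bounded :: "'a::linorder list \<Rightarrow> bool" where
  "rank_bounded xs \<longleftrightarrow> (\<forall>i<length xs. rank xs (xs ! i) \<le> i)"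

lemma length_standardize [simp]: "length (standardize xs) = length xs"
  by (simp add: standardize_def)

lemma rank_mono: "x \<le> y \<Longrightarrow> rank xs x \<le> rank xs y"
  unfolding rank_def by (rule card_mono) auto

lemma rank_subset: "set xs \<subseteq> set ys \<Longrightarrow> rank xs x \<le> rank ys x"
  unfolding rank_def by (rule card_mono) auto

lemma rank_psubset:
  assumes "set xs \<subseteq> set ys" "v \<in> set ys" "v \<notin> set xs" "v < x"
  shows "rank xs x < rank ys x"
  unfolding rank_def by (rule psubset_card_mono) (use assms in auto)

lemma rank_less_card: "x \<in> set xs \<Longrightarrow> rank xs x < card (set xs)"
  unfolding rank_def by (rule psubset_card_mono) auto

lemma rank_strict_mono_on: "strict_mono_on (set xs) (rank xs)"
  unfolding rank_def by (intro strict_mono_onI psubset_card_mono) auto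

lemma rank_image: "rank xs ` set xs = {..<card (set xs)}"
proof (rule card_subset_eq)
  show "rank xs ` set xs \<subseteq> {..<card (set xs)}"
    by (auto simp: rank_less_card)
  show "card (rank xs ` set xs) = card {..<card (set xs)}"
    using card_image[OF strict_mono_on_imp_inj_on[OF rank_strict_mono_on]] by simp
qed simp

lemma standardize_cayley: "standardize xs \<in> cayley_permutations"
proof (cases "xs = []")
  case True
  then show ?thesis by (simp add: standardize_def cayley_permutations_def)
next
  case False
  define n where "n = card (set xs)"
  have n: "n > 0"
    using False by (simp add: n_def card_gt_0_iff)
  have "set (standardize xs) = int ` {..<n}"
    unfolding standardize_def n_def rank_image[symmetric] by (simp add: image_image)
  also have "\<dots> = {0..<int n}"
    by (simp add: image_int_atLeastLessThan lessThan_atLeast0)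
  also have "\<dots> = {0..int n - 1}" by auto
  finally have "set (standardize xs) = {0..int n - 1}" .
  moreover have "Max {0..int n - 1} = int n - 1"
    using n by (intro Max_eqI) auto
  ultimately show ?thesis by (simp add: cayley_permutations_def)
qed

lemma standardize_inversion:
  "standardize xs \<in> inversion_sequences \<longleftrightarrow> rank_bounded xs"
  by (auto simp: inversion_sequences_def rank_bounded_def standardize_def)

lemma standardize_strict_mono_on: "strict_mono_on (set xs) (\<lambda>x. int (rank xs x))"
  using rank_strict_mono_on[of xs] by (auto simp: monotone_on_def)

lemma contains_standardize:
  assumes "subseq \<tau> \<sigma>" "\<tau> \<noteq> []"
  shows "contains \<sigma> (standardize \<tau>)"
proof -
  have "same_relative_order \<tau> (standardize \<tau>)"
    unfolding standardize_def
    by (rule same_relative_order_map[OF standardize_strict_mono_on])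
  then show ?thesis
    using assms by (auto simp: contains_iff standardize_def)
qed

lemma standardize_contains:
  assumes "contains \<tau> \<rho>"
  shows "contains (standardize \<tau>) \<rho>"
proof -
  have "\<tau> \<noteq> []" using assms by (auto simp: contains_def)
  moreover have "same_relative_order (standardize \<tau>) \<tau>"
    unfolding standardize_def
    by (rule same_relative_order_sym[OF same_relative_order_map[OF standardize_strict_mono_on]])
  ultimately have "contains (standardize \<tau>) \<tau>"
    by (auto simp: contains_iff)
  then show ?thesis using assms by (rule contains_trans)
qed

lemma inversion_imp_rank_bounded:
  assumes "\<sigma> \<in> inversion_sequences"
  shows "rank_bounded \<sigma>"
  unfolding rank_bounded_def
proof (intro allI impI)
  fix i assume i: "i < length \<sigma>"
  \<comment> \<open>All entries are nonnegative and the entry at \<open>i\<close> is at most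
    \<open>i\<close>.\<close>
  have "{y \<in> set \<sigma>. y < \<sigma> ! i} \<subseteq> {0..<int i}"
    using assms i by (fastforce simp: inversion_sequences_def in_set_conv_nth)
  then have "card {y \<in> set \<sigma>. y < \<sigma> ! i} \<le> card {0..<int i}"
    by (rule card_mono[rotated]) simp
  then show "rank \<sigma> (\<sigma> ! i) \<le> i"
    by (simp add: rank_def)
qed

section \<open>Deleting one entry\<close>

lemma rank_bounded_delete:
  assumes bdd: "rank_bounded (us @ v # vs)"
    and deletable: "v \<notin> set (us @ vs) \<or>
      (\<forall>i<length vs. rank (us @ v # vs) (vs ! i) \<noteq> Suc (length us + i))"
  shows "rank_bounded (us @ vs)"
  unfolding rank_bounded_def
proof (intro allI impI)
  fix i assume i: "i < length (us @ vs)"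
  let ?xs = "us @ v # vs"
  have bnd: "rank ?xs (?xs ! j) \<le> j" if "j < length ?xs" for j
    using bdd that by (auto simp: rank_bounded_def)
  have sub: "rank (us @ vs) x \<le> rank ?xs x" for x
    by (rule rank_subset) auto
  show "rank (us @ vs) ((us @ vs) ! i) \<le> i"
  proof (cases "i < length us")
    case True
    then show ?thesis
      using bnd[of i] sub[of "us ! i"] by (simp add: nth_append)
  next
    case False
    define l where "l = i - length us"
    have l: "i = length us + l" "l < length vs"
      using False i by (auto simp: l_def)
    \<comment> \<open>The entry now at index \<open>i\<close> stood at \<open>Suc i\<close>, so the
      bound is at risk only if that position was tight.\<close>
    have le: "rank ?xs (vs ! l) \<le> Suc i"
      using bnd[of "Suc i"] l by (simp add: nth_append)
    have "rank (us @ vs) (vs ! l) \<le> i"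
    proof (cases "rank ?xs (vs ! l) = Suc i")
      case True
      \<comment> \<open>The bound at the position of \<open>v\<close> itself keeps its rank below
        the tight rank \<open>Suc i\<close>, and ranks are monotone in the value.\<close>
      have "rank ?xs v \<le> length us"
        using bnd[of "length us"] by simp
      then have "rank ?xs v < rank ?xs (vs ! l)"
        using True l by simp
      then have "v < vs ! l"
        using rank_mono[of "vs ! l" v ?xs] by (meson not_le)
      moreover have "v \<notin> set (us @ vs)"
        using deletable True l by auto
      ultimately have "rank (us @ vs) (vs ! l) < rank ?xs (vs ! l)"
        by (intro rank_psubset[where v = v]) auto
      then show ?thesis using True by simp
    next
      case False
      then show ?thesis using le sub[of "vs ! l"] by linarith
    qed
    then show ?thesis using l by simp
  qed
qed

lemma subseq_nths_delete:
  fixes us vs :: "'a list"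
  assumes "length us \<notin> N"
  shows "subseq (nths (us @ v # vs) N) (us @ vs)"
proof -
  have "subseq (nths zs M) zs" for zs :: "'a list" and M
    by (auto simp: subseq_conv_nths)
  then show ?thesis
    using assms by (auto simp: nths_append nths_Cons intro!: list_emb_append_mono)
qed

section \<open>Counting repeated values\<close>

lemma card_ge_twice_card_image:
  assumes "finite W" and two: "\<And>y. y \<in> f ` W \<Longrightarrow> 2 \<le> card {x \<in> W. f x = y}"
  shows "2 * card (f ` W) \<le> card W"
proof -
  have "2 * card (f ` W) = (\<Sum>y\<in>f ` W. 2)" by simp
  also have "\<dots> \<le> (\<Sum>y\<in>f ` W. card {x \<in> W. f x = y})"
    using two by (rule sum_mono)
  also have "\<dots> = card W"
    using sum.image_gen[OF assms(1), of "\<lambda>_. 1::nat" f] by simp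
  finally show ?thesis .
qed

text \<open>Each repeated value takes up at least two positions of \<open>W\<close>, so the number
  of distinct values is at most the length minus half of \<open>card W\<close>.\<close>

lemma card_repeated_le:
  fixes xs :: "'a list"
  defines "W \<equiv> {j. j < length xs \<and> (\<exists>i<length xs. i \<noteq> j \<and> xs ! i = xs ! j)}"
  shows "card W \<le> 2 * (length xs - card (set xs))"
proof -
  define U where "U = {..<length xs} - W"
  have W: "W \<subseteq> {..<length xs}" "finite W" by (auto simp: W_def)
  have "2 * card ((!) xs ` W) \<le> card W"
  proof (rule card_ge_twice_card_image[OF W(2)])
    fix y assume "y \<in> (!) xs ` W"
    then obtain i j where ij: "j < length xs" "i < length xs" "i \<noteq> j" "xs ! i = y" "xs ! j = y"
      by (auto simp: W_def)
    then have "{i, j} \<subseteq> {x \<in> W. xs ! x = y}"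
      unfolding W_def by auto
    then have "card {i, j} \<le> card {x \<in> W. xs ! x = y}"
      using W(2) by (intro card_mono) auto
    then show "2 \<le> card {x \<in> W. xs ! x = y}" using ij by simp
  qed
  moreover have "card (set xs) \<le> card U + card ((!) xs ` W)"
  proof -
    have "set xs = (!) xs ` U \<union> (!) xs ` W"
      using W(1) by (force simp: U_def set_conv_nth)
    then have "card (set xs) \<le> card ((!) xs ` U) + card ((!) xs ` W)"
      by (metis card_Un_le)
    moreover have "card ((!) xs ` U) \<le> card U"
      by (rule card_image_le) (simp add: U_def)
    ultimately show ?thesis by linarith
  qed
  moreover have "card U + card W = length xs"
    using W card_mono[OF _ W(1)] by (simp add: U_def card_Diff_subset)
  ultimately show ?thesis by linarith
qed

text \<open>\<open>N\<close> marks the occurrence. If every deletion outside \<open>N\<close> broke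
  the rank bounds, the marked positions would make up at least a third of the list.\<close>

lemma ex_deletable:
  assumes bdd: "rank_bounded xs" and long: "length xs > 3 * card {i. i < length xs \<and> i \<in> N}"
  obtains us v vs where "xs = us @ v # vs" "length us \<notin> N" "rank_bounded (us @ vs)"
proof (rule ccontr)
  assume "\<not> thesis"
  with that have stuck: "\<not> rank_bounded (us @ vs)"
    if "xs = us @ v # vs" "length us \<notin> N" for us v vs
    using that by blast
  define S where "S = {i. i < length xs \<and> i \<in> N}"
  define A where "A = {i. i < length xs \<and> i \<notin> N}"
  define T where "T = {i. i < length xs \<and> rank xs (xs ! i) = i}"
  define W where "W = {j. j < length xs \<and> (\<exists>i<length xs. i \<noteq> j \<and> xs ! i = xs ! j)}"
  have fin: "finite S" "finite A" "finite T" "finite W"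
    by (auto simp: S_def A_def T_def W_def)
  \<comment> \<open>Contrapositive of \<open>rank_bounded_delete\<close>: a position that cannot be
    deleted has a repeated value and a tight position after it.\<close>
  have A: "j \<in> W \<and> (\<exists>i\<in>T. j < i)" if "j \<in> A" for j
  proof -
    define us v vs where "us = take j xs" and "v = xs ! j" and "vs = drop (Suc j) xs"
    have j: "j < length xs" "j \<notin> N" using that by (auto simp: A_def)
    then have xs: "xs = us @ v # vs" and us: "length us = j"
      by (auto simp: us_def v_def vs_def id_take_nth_drop[symmetric])
    have "\<not> rank_bounded (us @ vs)"
      using stuck[OF xs] us j by simp
    then have "v \<in> set (us @ vs)"
      and ex: "\<exists>i<length vs. rank xs (vs ! i) = Suc (length us + i)"
      using rank_bounded_delete[of us v vs] bdd xs by auto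
    from this(1) consider i where "i < length us" "us ! i = v" | i where "i < length vs" "vs ! i = v"
      by (auto simp: in_set_conv_nth)
    then have "j \<in> W"
    proof cases
      case 1
      then have "i < length xs" "i \<noteq> j" "xs ! i = xs ! j"
        using us v_def by (auto simp: us_def)
      then show ?thesis using j by (auto simp: W_def)
    next
      case 2
      then have "Suc (j + i) < length xs" "Suc (j + i) \<noteq> j" "xs ! Suc (j + i) = xs ! j"
        by (auto simp: v_def vs_def)
      then show ?thesis using j unfolding W_def by blast
    qed
    moreover have "\<exists>i\<in>T. j < i"
    proof -
      obtain i where i: "i < length vs" "rank xs (vs ! i) = Suc (j + i)"
        using ex us by auto
      then have "Suc (j + i) \<in> T"
        by (auto simp: T_def vs_def)
      then show ?thesis by (intro bexI[of _ "Suc (j + i)"]) auto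
    qed
    ultimately show ?thesis ..
  qed
  have "{..<length xs} = A \<union> S" "A \<inter> S = {}"
    by (auto simp: A_def S_def)
  then have "length xs = card A + card S"
    using fin card_Un_disjoint[of A S] by (metis card_lessThan)
  moreover have "card A \<le> 2 * card S"
  proof (cases "A = {}")
    case False
    define t where "t = Max T"
    have "T \<noteq> {}" using False A by auto
    then have t: "t \<in> T" and tmax: "\<And>i. i \<in> T \<Longrightarrow> i \<le> t"
      using fin by (auto simp: t_def)
    \<comment> \<open>A position of \<open>A\<close> beyond \<open>t\<close> would have a tight
      position after it, against the maximality of \<open>t\<close>.\<close>
    have "{t<..<length xs} \<subseteq> S"
      using A tmax by (fastforce simp: S_def A_def)
    then have "card {t<..<length xs} \<le> card S"
      using fin by (intro card_mono)
    then have "length xs \<le> Suc t + card S" by simp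
    \<comment> \<open>By tightness \<open>t\<close> is itself the rank of an entry. Hence the length
      exceeds the number of distinct values by at most \<open>card S\<close>.\<close>
    moreover have "t < card (set xs)"
      using t rank_less_card[of "xs ! t" xs] by (auto simp: T_def)
    moreover have "card A \<le> card W"
      using A fin by (intro card_mono) auto
    moreover have "card W \<le> 2 * (length xs - card (set xs))"
      unfolding W_def by (rule card_repeated_le)
    ultimately show ?thesis by linarith
  qed simp
  ultimately show False
    using long by (simp add: S_def)
qed

text \<open>Strong induction replaces the choice of a shortest subsequence. Each round picks a fresh
  occurrence, so none has to be tracked through the deletions.\<close>

lemma ex_short_rank_bounded_subseq:
  assumes "rank_bounded \<sigma>" "contains \<sigma> \<rho>"
  shows "\<exists>\<tau>. subseq \<tau> \<sigma> \<and> rank_bounded \<tau> \<and> contains \<tau> \<rho> \<and> length \<tau> \<le> 3 * length \<rho>"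
  using assms
proof (induction "length \<sigma>" arbitrary: \<sigma> rule: less_induct)
  case less
  show ?case
  proof (cases "length \<sigma> \<le> 3 * length \<rho>")
    case True
    then show ?thesis using less.prems by blast
  next
    case False
    obtain N where N: "same_relative_order (nths \<sigma> N) \<rho>" and "\<rho> \<noteq> []"
      using less.prems(2) by (auto simp: contains_iff subseq_conv_nths)
    \<comment> \<open>\<open>N\<close> may contain indices past the end of \<open>\<sigma>\<close>,
      which \<open>nths\<close> ignores.\<close>
    then have "length \<rho> = card {i. i < length \<sigma> \<and> i \<in> N}"
      by (simp add: same_relative_order_def length_nths)
    then obtain us v vs where uv: "\<sigma> = us @ v # vs" "length us \<notin> N" "rank_bounded (us @ vs)"
      using ex_deletable[OF less.prems(1), of N] False by (metis not_le)
    have "contains (us @ vs) \<rho>"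
      using subseq_nths_delete[OF uv(2)] N \<open>\<rho> \<noteq> []\<close> uv(1) by (auto simp: contains_iff)
    then obtain \<tau> where "subseq \<tau> (us @ vs)" "rank_bounded \<tau>" "contains \<tau> \<rho>"
      "length \<tau> \<le> 3 * length \<rho>"
      using less.hyps[of "us @ vs"] uv by auto
    moreover have "subseq (us @ vs) \<sigma>"
      using uv(1) by (auto intro: list_emb_append_mono)
    ultimately show ?thesis
      using subseq_order.trans by blast
  qed
qed

section \<open>The finite set of new patterns\<close>

lemma finite_inversion_sequences: "finite {q \<in> inversion_sequences. length q \<le> n}"
proof (rule finite_subset)
  show "{q \<in> inversion_sequences. length q \<le> n} \<subseteq> {q. set q \<subseteq> {0..int n} \<and> length q \<le> n}"
    by (fastforce simp: inversion_sequences_def in_set_conv_nth)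
qed (simp add: finite_lists_length_le)

theorem theorem3p5:
  fixes P :: "int list set"
  assumes "finite P" and "P \<subseteq> cayley_permutations" and "[] \<notin> P"
  shows "\<exists>Q. finite Q \<and> Q \<subseteq> inversion_sequences \<inter> cayley_permutations \<and>
           inversion_sequences_avoiding P = inversion_sequences_avoiding Q"
proof -
  obtain n where n: "\<And>\<rho>. \<rho> \<in> P \<Longrightarrow> length \<rho> \<le> n"
    using assms(1) finite_nat_set_iff_bounded_le[of "length ` P"] by auto
  \<comment> \<open>All candidates up to the length bound are taken, minimal or not: by
    \<open>contains_trans\<close>, avoiding \<open>P\<close> already forces avoiding each of
    them.\<close>
  define Q where "Q = {q \<in> inversion_sequences \<inter> cayley_permutations.
    length q \<le> 3 * n \<and> (\<exists>\<rho>\<in>P. contains q \<rho>)}"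
  have "finite Q"
    by (rule finite_subset[OF _ finite_inversion_sequences[of "3 * n"]]) (auto simp: Q_def)
  moreover have "(\<exists>\<rho>\<in>P. contains \<sigma> \<rho>) \<longleftrightarrow> (\<exists>q\<in>Q. contains \<sigma> q)"
    if \<sigma>: "\<sigma> \<in> inversion_sequences" for \<sigma>
  proof
    assume "\<exists>\<rho>\<in>P. contains \<sigma> \<rho>"
    then obtain \<rho> where \<rho>: "\<rho> \<in> P" "contains \<sigma> \<rho>" by blast
    obtain \<tau> where \<tau>: "subseq \<tau> \<sigma>" "rank_bounded \<tau>" "contains \<tau> \<rho>" "length \<tau> \<le> 3 * length \<rho>"
      using ex_short_rank_bounded_subseq[OF inversion_imp_rank_bounded[OF \<sigma>] \<rho>(2)] by blast
    \<comment> \<open>\<open>\<tau>\<close> keeps its values from \<open>\<sigma>\<close> and may be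
      neither a Cayley permutation nor an inversion sequence; its standardization is both.\<close>
    have "standardize \<tau> \<in> Q"
      using \<tau> \<rho>(1) n[OF \<rho>(1)] standardize_contains
      by (auto simp: Q_def standardize_inversion standardize_cayley)
    moreover have "contains \<sigma> (standardize \<tau>)"
      using \<tau>(1,3) by (intro contains_standardize) (auto simp: contains_def)
    ultimately show "\<exists>q\<in>Q. contains \<sigma> q" by blast
  next
    assume "\<exists>q\<in>Q. contains \<sigma> q"
    then show "\<exists>\<rho>\<in>P. contains \<sigma> \<rho>"
      using contains_trans by (fastforce simp: Q_def)
  qed
  then have "inversion_sequences_avoiding P = inversion_sequences_avoiding Q"
    by (auto simp: inversion_sequences_avoiding_def avoids_def)
  ultimately show ?thesis
    by (intro exI[of _ Q]) (auto simp: Q_def)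
qed

end
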